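(* Let $m\ge 2$ be an integer. If there exists a complex $2$-regular map of $S^m$ into $\mathbb{C}^N$, then $N\ge\left[\frac{m}{2}\right]+2$.
   Context: All maps are continuous. A map $f:M\to\mathbb{C}^N$ from a smooth manifold $M$ is called complex $k$-regular ($k\ge 2$) if for any $k$ distinct points $x_1,\dots,x_k\in M$ the vectors $f(x_1),\dots,f(x_k)$ are linearly independent over $\mathbb{C}$. $S^m$ is the $m$-sphere. $[x]$ denotes the integer part of $x$. *)

theory Defs
  imports "HOL-Analysis.Analysis"
begin

text \<open>
  The independence of the \<open>k\<close> vectors is meant as independence of a family: it excludes
  repetitions, whereas \<open>vec.independent\<close> is a property of the set of vectors. Hence the
  injectivity condition. The scalar multiplication behind \<open>vec.independent\<close> is \<open>(*s)\<close>, so this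
  is independence over the complex numbers; the unqualified \<open>independent\<close> would be
  independence over the reals.
\<close>

definition complex_regular ::
  "nat \<Rightarrow> 'a::topological_space set \<Rightarrow> ('a \<Rightarrow> complex ^ 'n) \<Rightarrow> bool" where
  "complex_regular k M f \<longleftrightarrow>
     continuous_on M f \<and>
     (\<forall>X. X \<subseteq> M \<and> finite X \<and> card X = k \<longrightarrow> inj_on f X \<and> vec.independent (f ` X))"

end

theory Submission
  imports Defs
begin

text \<open>
  Normalise \<open>f\<close> to unit length. Regularity says that \<open>F (x, c) = c f(x)\<close>, for \<open>x \<in> S\<^sup>m\<close>
  and \<open>c\<close> in the unit circle, is injective into the unit sphere of complex \<open>N\<close>-space. If
  \<open>2 N \<le> m + 2\<close>, then by invariance of domain the image of \<open>F\<close> is open; it is also compact, so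
  \<open>F\<close> is a homeomorphism onto the sphere. The circle component \<open>g\<close> of its inverse satisfies
  \<open>g (c z) = c g z\<close>. For \<open>N \<ge> 2\<close> each orbit of the circle bounds a disc in the sphere, so \<open>g\<close>
  would yield a retraction of the disc onto its boundary.
\<close>

lemma norm_vector_scalar_mult:
  fixes c :: "'a::real_normed_div_algebra" and x :: "'a ^ 'n"
  shows "norm (c *s x) = norm c * norm x"
  by (simp add: norm_vec_def vector_scalar_mult_def norm_mult L2_set_right_distrib)

lemma scaleR_eq_vector_scalar_mult:
  fixes x :: "'a::real_algebra_1 ^ 'n"
  shows "r *\<^sub>R x = of_real r *s x"
  by (simp add: vec_eq_iff scaleR_conv_of_real[of r "x $ i" for i])

lemma continuous_on_vector_scalar_mult [continuous_intros]:
  fixes f :: "'b::topological_space \<Rightarrow> 'a::real_normed_algebra" and g :: "'b \<Rightarrow> 'a ^ 'n"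
  assumes "continuous_on S f" "continuous_on S g"
  shows "continuous_on S (\<lambda>x. f x *s g x)"
  unfolding vector_scalar_mult_def by (intro continuous_intros assms)

text \<open>If \<open>c\<close> were nonzero, dividing by it would put \<open>f x\<close> in the
  span of \<open>f y\<close>. With suitable coefficients this yields that \<open>f\<close> has no
  zeros, that \<open>F\<close> is injective, and that complex dimension one is impossible.\<close>

lemma complex_regular_2_scaled_eqD:
  assumes "complex_regular 2 M f" "x \<in> M" "y \<in> M" "x \<noteq> y" "c *s f x = d *s f y"
  shows "c = 0"
proof (rule ccontr)
  assume "c \<noteq> 0"
  have "{x, y} \<subseteq> M \<and> finite {x, y} \<and> card {x, y} = 2"
    using assms(2-4) by simp
  then have "inj_on f {x, y}" "vec.independent (f ` {x, y})"
    using assms(1) unfolding complex_regular_def by blast+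
  then have ne: "f x \<noteq> f y" and ind: "vec.independent {f x, f y}"
    using assms(4) by auto
  have "f x = (1 / c) *s (c *s f x)"
    using \<open>c \<noteq> 0\<close> by (simp add: vector_smult_assoc)
  also have "\<dots> = (d / c) *s f y"
    unfolding assms(5) by (simp add: vector_smult_assoc)
  also have "\<dots> \<in> vec.span ({f x, f y} - {f x})"
    using ne by (intro vec.span_scale vec.span_base) auto
  finally have "f x \<in> vec.span ({f x, f y} - {f x})" .
  then show False
    using ind unfolding vec.dependent_def by blast
qed

text \<open>Complex dimension one is a genuine exception: there the single coordinate of
  \<open>z\<close> is such a map \<open>g\<close>.\<close>

lemma no_equivariant_map_to_circle:
  fixes g :: "complex ^ 'd \<Rightarrow> complex"
  assumes cont: "continuous_on (sphere 0 1) g"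
    and norm_g: "\<And>z. z \<in> sphere 0 1 \<Longrightarrow> norm (g z) = 1"
    and equi: "\<And>c z. norm c = 1 \<Longrightarrow> z \<in> sphere 0 1 \<Longrightarrow> g (c *s z) = c * g z"
  shows "CARD('d) < 2"
proof (rule ccontr)
  assume "\<not> CARD('d) < 2"
  then obtain a b :: 'd where ab: "a \<noteq> b"
    by (metis (full_types) ex_card card_2_iff not_less)
  \<comment> \<open>a disc whose boundary is a single orbit of the circle\<close>
  define e where "e w = (\<chi> i. if i = a then w else
      if i = b then complex_of_real (sqrt (1 - (norm w)\<^sup>2)) else 0)" for w :: complex
  have e_sphere: "e w \<in> sphere 0 1" if "w \<in> cball 0 1" for w
  proof -
    have "(norm w)\<^sup>2 \<le> 1"
      using that by (simp add: power_le_one)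
    then have "(\<Sum>i\<in>UNIV. (norm (e w $ i))\<^sup>2) =
        (\<Sum>i\<in>UNIV. (if i = a then (norm w)\<^sup>2 else 0) + (if i = b then 1 - (norm w)\<^sup>2 else 0))"
      using ab by (intro sum.cong) (auto simp: e_def)
    also have "\<dots> = 1"
      by (simp add: sum.distrib)
    finally show ?thesis
      by (simp add: norm_vec_def L2_set_def)
  qed
  \<comment> \<open>For \<open>norm w = 1\<close> the square root vanishes, so only coordinate
    \<open>a\<close> survives.\<close>
  have e_bdry: "e w = w *s e 1" if "norm w = 1" for w
    using that by (simp add: e_def vec_eq_iff)
  have "continuous_on (cball 0 1) e"
    unfolding e_def
  proof (intro continuous_on_vec_lambda)
    show "continuous_on (cball 0 1) (\<lambda>w. if i = a then w else
        if i = b then complex_of_real (sqrt (1 - (norm w)\<^sup>2)) else 0)" for i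
      by (cases "i = a"; cases "i = b") (auto intro!: continuous_intros)
  qed
  then have cont_ge: "continuous_on (cball 0 1) (\<lambda>w. g (e w))"
    by (rule continuous_on_compose2[OF cont]) (use e_sphere in blast)
  have e1: "e 1 \<in> sphere 0 1" "g (e 1) \<noteq> 0" "norm (g (e 1)) = 1"
    using e_sphere[of 1] norm_g[of "e 1"] by auto
  \<comment> \<open>On the boundary, equivariance gives \<open>g (e w) = w * g (e 1)\<close>;
    dividing by the unit number \<open>g (e 1)\<close> turns this into the identity.\<close>
  have "retraction (cball 0 1) (sphere 0 1) (\<lambda>w. g (e w) / g (e 1))"
    unfolding retraction_def
  proof (intro conjI ballI)
    show "continuous_on (cball 0 1) (\<lambda>w. g (e w) / g (e 1))"
      using cont_ge e1 by (intro continuous_intros) auto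
    show "(\<lambda>w. g (e w) / g (e 1)) \<in> cball 0 1 \<rightarrow> sphere 0 1"
      using norm_g e_sphere e1 by (auto simp: norm_divide)
    show "g (e w) / g (e 1) = w" if "w \<in> sphere 0 1" for w
      using that e1 by (simp add: e_bdry[of w] equi)
  qed (simp add: sphere_cball)
  then show False
    using no_retraction_cball[of 1 "0::complex"] by (auto simp: retract_of_def)
qed

text \<open>By \<open>dim\<close>, the target sphere, of dimension \<open>2 * CARD('d) - 1\<close>,
  has at most the dimension \<open>DIM('a)\<close> of the product. The image is then open and closed
  in a connected sphere, and it is nonempty.\<close>

lemma unit_multiples_cover_sphere:
  fixes f :: "'a::euclidean_space \<Rightarrow> complex ^ 'd"
  assumes cont: "continuous_on (sphere 0 1) f"
    and norm_f: "\<And>x. x \<in> sphere 0 1 \<Longrightarrow> norm (f x) = 1"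
    and inj: "inj_on (\<lambda>(x, c). c *s f x) (sphere 0 1 \<times> sphere 0 1)"
    and dim: "2 * CARD('d) \<le> DIM('a) + 1"
  shows "(\<lambda>(x, c). c *s f x) ` (sphere 0 1 \<times> sphere 0 1) = sphere 0 1" (is "?I = _")
proof -
  \<comment> \<open>Polar coordinates extend the map to an open subset of a Euclidean space, where invariance of
    domain applies; it is injective as long as the angle stays in a short interval.\<close>
  define G where "G = (\<lambda>(v::'a, \<theta>). (norm v * cis \<theta>) *s f (v /\<^sub>R norm v))"
  have G_open: "open (G ` ((- {0}) \<times> {t<..<t + pi}))" (is "open (G ` ?S)") for t
  proof (rule invariance_of_domain_gen)
    show "open ?S"
      by (intro open_Times) auto
    have "continuous_on ?S (\<lambda>p. f (fst p /\<^sub>R norm (fst p)))"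
      by (rule continuous_on_compose2[OF cont]) (auto intro!: continuous_intros
          simp: divide_simps split: if_splits)
    moreover have "continuous_on ?S (\<lambda>p. complex_of_real (norm (fst p)) * cis (snd p))"
      by (intro continuous_intros)
    ultimately show "continuous_on ?S G"
      unfolding G_def case_prod_unfold by (rule continuous_on_vector_scalar_mult[rotated])
    show "inj_on G ?S"
    proof (rule inj_onI, unfold split_paired_all)
      fix v v' :: 'a and s s' :: real
      assume "G (v, s) = G (v', s')" "(v, s) \<in> ?S" "(v', s') \<in> ?S"
      then have *: "G (v, s) = G (v', s')" "v \<noteq> 0" "v' \<noteq> 0"
          "s \<in> {t<..<t + pi}" "s' \<in> {t<..<t + pi}"
        by auto
      \<comment> \<open>Since \<open>f\<close> takes unit values, the radius can be read off from
        the norm; the hypothesis \<open>inj\<close> then separates directions and phases.\<close>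
      have "norm (G (v, s)) = norm v" "norm (G (v', s')) = norm v'"
        using *(2,3) by (simp_all add: G_def norm_vector_scalar_mult norm_mult norm_f)
      then have n: "norm v = norm v'"
        using * by simp
      have "norm v *\<^sub>R (cis s *s f (v /\<^sub>R norm v)) = norm v *\<^sub>R (cis s' *s f (v' /\<^sub>R norm v'))"
        using *(1) n by (simp add: G_def scaleR_eq_vector_scalar_mult vector_smult_assoc)
      then have "cis s *s f (v /\<^sub>R norm v) = cis s' *s f (v' /\<^sub>R norm v')"
        using *(2) by simp
      then have "(v /\<^sub>R norm v, cis s) = (v' /\<^sub>R norm v', cis s')"
        using *(2,3) by (intro inj_onD[OF inj]) auto
      then have "v = v'" "cis s = cis s'"
        using n *(2,3) by auto
      moreover have "s = s'"
      proof -
        have "cis (s - s') = 1"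
          using \<open>cis s = cis s'\<close> by (simp flip: cis_divide)
        then have "cos (s - s') = 1"
          by (metis cis.simps(1) one_complex.simps(1))
        then obtain k :: int where k: "s - s' = k * (2 * pi)"
          unfolding cos_one_2pi_int by auto
        have "\<bar>s - s'\<bar> < 2 * pi"
          using *(4,5) by auto
        then have "\<bar>real_of_int k\<bar> < 1"
          unfolding k by (simp add: abs_mult)
        then have "k = 0"
          by linarith
        with k show ?thesis
          by simp
      qed
      ultimately show "(v, s) = (v', s')"
        by simp
    qed
    show "DIM(complex ^ 'd) \<le> DIM('a \<times> real)"
      using dim by simp
  qed
  \<comment> \<open>As \<open>G\<close> preserves the radius, its values on the unit sphere come
    exactly from unit vectors \<open>v\<close>. Letting \<open>t\<close> vary makes the short
    intervals reach every phase.\<close>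
  have I_eq: "?I = sphere 0 1 \<inter> (\<Union>t. G ` ((- {0}) \<times> {t<..<t + pi}))"
  proof (intro equalityI subsetI)
    fix z assume "z \<in> ?I"
    then obtain x c where xc: "norm x = 1" "norm c = 1" "z = c *s f x"
      by auto
    then obtain s where "c = cis s"
      by (metis cis_Arg sgn_eq div_by_1 norm_zero of_real_1 zero_neq_one)
    then have "z = G (x, s)" "s \<in> {s - 1 <..<s - 1 + pi}"
      using xc pi_gt3 by (auto simp: G_def)
    moreover have "z \<in> sphere 0 1" "x \<noteq> 0"
      using xc norm_f by (auto simp: norm_vector_scalar_mult)
    ultimately show "z \<in> sphere 0 1 \<inter> (\<Union>t. G ` ((- {0}) \<times> {t<..<t + pi}))"
      by blast
  next
    fix z assume "z \<in> sphere 0 1 \<inter> (\<Union>t. G ` ((- {0}) \<times> {t<..<t + pi}))"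
    then obtain v s where vs: "norm z = 1" "v \<noteq> 0" "z = G (v, s)"
      by auto
    then have "norm v = 1"
      by (simp add: G_def norm_vector_scalar_mult norm_mult norm_f)
    then show "z \<in> ?I"
      using vs by (intro rev_image_eqI[of "(v, cis s)"]) (auto simp: G_def)
  qed
  have "openin (top_of_set (sphere 0 1)) ?I"
    unfolding I_eq using G_open by (intro openin_open_Int open_UN) auto
  moreover have "compact ?I"
    unfolding case_prod_unfold
    by (intro compact_continuous_image compact_Times compact_sphere continuous_intros
        continuous_on_compose2[OF cont]) auto
  then have "closedin (top_of_set (sphere 0 1)) ?I"
    using I_eq by (intro closed_subset compact_imp_closed) auto
  moreover have "connected (sphere 0 1 :: (complex ^ 'd) set)"
    by (rule connected_sphere) simp
  ultimately have "?I = {} \<or> ?I = sphere 0 1"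
    unfolding connected_clopen by blast
  then show ?thesis
    by simp
qed

theorem proposition8p3:
  fixes m N :: nat
  assumes "m \<ge> 2"
    and "CARD('s::finite) = m + 1"
    and "CARD('d::finite) = N"
    and "\<exists>f :: real ^ 's \<Rightarrow> complex ^ 'd. complex_regular 2 (sphere 0 1) f"
  shows "N \<ge> m div 2 + 2"
proof (rule ccontr)
  assume "\<not> N \<ge> m div 2 + 2"
  \<comment> \<open>The negated bound \<open>N \<le> m div 2 + 1\<close> gives
    \<open>2 * N \<le> m + 2\<close>, and \<open>DIM(real ^ 's)\<close> is
    \<open>m + 1\<close>.\<close>
  then have dim: "2 * CARD('d) \<le> DIM(real ^ 's) + 1"
    using assms(2,3) by auto
  obtain f :: "real ^ 's \<Rightarrow> complex ^ 'd" where f: "complex_regular 2 (sphere 0 1) f"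
    using assms(4) by blast
  have neg_ne: "x \<noteq> - x" if "x \<in> sphere 0 1" for x :: "real ^ 's"
  proof
    assume "x = - x"
    then have "2 *\<^sub>R x = 0"
      by (simp add: scaleR_2 flip: eq_neg_iff_add_eq_0)
    then show False
      using that by simp
  qed
  \<comment> \<open>The antipode serves as the second point: a zero of \<open>f\<close> at
    \<open>x\<close> would give \<open>1 *s f x = 0 *s f (- x)\<close>.\<close>
  have f_ne0: "f x \<noteq> 0" if "x \<in> sphere 0 1" for x
    using complex_regular_2_scaled_eqD[OF f that _ neg_ne[OF that], of 1 0] that by auto
  define f1 where "f1 x = f x /\<^sub>R norm (f x)" for x
  have norm_f1: "norm (f1 x) = 1" if "x \<in> sphere 0 1" for x
    using f_ne0[OF that] by (simp add: f1_def)
  have cont_f1: "continuous_on (sphere 0 1) f1"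
    using f f_ne0 unfolding f1_def complex_regular_def by (intro continuous_intros) auto
  define F where "F = (\<lambda>(x, c). c *s f1 x)"
  let ?K = "sphere 0 1 \<times> sphere 0 1 :: ((real ^ 's) \<times> complex) set"
  have inj: "inj_on F ?K"
  proof (rule inj_onI, clarify)
    fix x y :: "real ^ 's" and c d :: complex
    assume *: "F (x, c) = F (y, d)" "x \<in> sphere 0 1" "y \<in> sphere 0 1"
      "c \<in> sphere 0 1" "d \<in> sphere 0 1"
    have "(c / norm (f x)) *s f x = (d / norm (f y)) *s f y"
      using *(1) by (simp add: F_def f1_def scaleR_eq_vector_scalar_mult vector_smult_assoc
          divide_inverse)
    then have "x = y"
      using complex_regular_2_scaled_eqD[OF f *(2,3)] f_ne0[OF *(2)] *(4) by force
    moreover from this have "c = d"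
      using * norm_f1[of y] by (auto simp: F_def)
    ultimately show "x = y \<and> c = d"
      by simp
  qed
  have cont: "continuous_on ?K F"
    unfolding F_def case_prod_unfold
    by (intro continuous_intros continuous_on_compose2[OF cont_f1]) auto
  have im: "F ` ?K = sphere 0 1"
    using unit_multiples_cover_sphere[OF cont_f1 norm_f1 _ dim] inj unfolding F_def by blast
  define g where "g = (\<lambda>z. snd (inv_into ?K F z))"
  have g_F: "g (F (x, c)) = c" if "x \<in> sphere 0 1" "c \<in> sphere 0 1" for x c
    using that inj by (simp add: g_def inv_into_f_f)
  have "continuous_on (F ` ?K) (inv_into ?K F)"
    using inj by (intro continuous_on_inv cont compact_Times compact_sphere) auto
  then have "continuous_on (sphere 0 1) g"
    unfolding g_def im by (intro continuous_intros)
  moreover have "norm (g z) = 1" if "z \<in> sphere 0 1" for z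
    using that g_F unfolding im[symmetric] by auto
  moreover have "g (c *s z) = c * g z" if c: "norm c = 1" and z: "z \<in> sphere 0 1" for c z
  proof -
    obtain x d where xd: "x \<in> sphere 0 1" "d \<in> sphere 0 1" "z = F (x, d)"
      using z unfolding im[symmetric] by auto
    then have "c *s z = F (x, c * d)"
      by (simp add: F_def vector_smult_assoc)
    then show ?thesis
      using c xd by (simp add: g_F norm_mult)
  qed
  ultimately have "CARD('d) < 2"
    by (rule no_equivariant_map_to_circle)
  then have N1: "CARD('d) = 1"
    using zero_less_card_finite[where 'a='d] by linarith
  then obtain a :: 'd where a: "UNIV = {a}"
    by (auto simp: card_1_singleton_iff)
  obtain x :: "real ^ 's" where x: "x \<in> sphere 0 1"
    using vector_choose_size[of 1, where 'a = "real ^ 's"] by auto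
  \<comment> \<open>In one complex dimension any two vectors satisfy this relation, by
    commutativity. Regularity makes its left coefficient vanish, which forces a zero of
    \<open>f\<close>.\<close>
  have "f (- x) $ a *s f x = f x $ a *s f (- x)"
    using a by (auto simp: vec_eq_iff mult.commute)
  then have "f (- x) $ a = 0"
    using complex_regular_2_scaled_eqD[OF f _ _ neg_ne[OF x]] x by auto
  then have "f (- x) = 0"
    using a by (metis (full_types) UNIV_I singletonD vec_eq_iff zero_index)
  then show False
    using f_ne0[of "- x"] x by simp
qed

end
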